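(* Let $q$ and $n$ be positive integers with $q>n$, and let $\varepsilon>0$. Let $g_0,\ldots,g_n:\mathbb{R}\to\mathbb{R}$ be $n+1$ tropical entire functions without common roots (no root common to all of them), linearly independent in the Gondran-Minoux sense. Let the $q+1$ tropical linear combinations $f_0,\ldots,f_q$ of the $g_j$ over the semiring $\mathbb{R}_{\max}$ be defined by $$f_k(x)=a_{0k}\odot g_0(x)\oplus a_{1k}\odot g_1(x)\oplus\cdots\oplus a_{nk}\odot g_n(x)=\max_{0\le i\le n}\{a_{ik}+g_i(x)\},\qquad 0\le k\le q .$$ Let $\lambda=\mathrm{ddg}(\{f_{n+1},\ldots,f_q\})$ be the degree of degeneracy, and let $$\tilde L=\bigl(f_0\odot\overline{f}_1\odot\cdots\odot\overline{f}_n^{[n]}\odot f_{n+1}\odot\cdots\odot f_q\bigr)\oslash C_\circ(f_0,f_1,\ldots,f_n).$$ If the tropical holomorphic curve $g$ of $\mathbb{R}$ into $\mathbb{TP}^n$ has reduced representation $\mathbf{g}=(g_0,\ldots,g_n)$, then $$\begin{aligned}(q-n-\lambda)T_g(r)\le{}& N(r,1_\circ\oslash\tilde L)-N(r,\tilde L)\\&+\sum_{j=1}^q\sum_{l=0}^n\sum_{m=0}^n m\Bigl(r,\bigl(\overline{f}_j^{[l]}\oslash\overline{f}_0^{[l]}\bigr)\oslash\bigl(\overline{f}_j^{[m]}\oslash\overline{f}_0^{[m]}\bigr)\Bigr)\\&+L(0)+\sum_{j=1}^n\Bigl(\max_{0\le i\le n}\{a_{ij}+g_i(j)\}-\max_{0\le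 i\le n}\{a_{ij}+g_i(0)\}\Bigr)\\&-\sum_{\substack{\nu=n+1\\ \mathrm{card}(I_\nu)=n+1}}^q\ \min_{j\in I_\nu}\{a_{j\nu}\}-\sum_{\substack{\nu=n+1\\ \mathrm{card}(I_\nu)<n+1}}^q\ \max_{j\in I_\nu}\{a_{j\nu}+g_j(0)\}\\&-(q-n-\lambda)\max_{j\in\{0,\ldots,n\}}\{g_j(0)\},\end{aligned}$$ where the set $I_\nu$ consists of all indices $j\in\{0,\ldots,n\}$ such that $a_{j\nu}\neq-\infty$, and $$L=\bigl(f_0\odot f_1\odot\cdots\odot f_n\odot f_{n+1}\odot\cdots\odot f_q\bigr)\oslash C_\circ(f_0,f_1,\ldots,f_n).$$
   Context: Tropical arithmetic: $\mathbb{R}_{\max}=\mathbb{R}\cup\{-\infty\}$, $0_\circ=-\infty$, $1_\circ=0$, $a\oplus b=\max\{a,b\}$, $a\odot b=a+b$, $a\oslash b=a-b$ (for $b\neq0_\circ$); operations on functions are pointwise. Shifts (step $1$): $\overline{f}^{[k]}(x)=f(x+k)$, $\overline{f}=\overline{f}^{[1]}$. A tropical meromorphic function is a continuous piecewise linear function $f:\mathbb{R}\to\mathbb{R}$ (real slopes; the points where the slope changes form a discrete set with no finite limit points). Put $\omega_f(x)=\lim_{\varepsilon\to0+}(f'(x+\varepsilon)-f'(x-\varepsilon))$. A point $x$ is a pole of $f$ if $\omega_f(x)<0$ and a root if $\omega_f(x)>0$, with multiplicity $|\omega_f(x)|$. A tropical entire function is a tropical meromorphic function without poles (equivalently, a convex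 one). Nevanlinna functions: $m(r,f)=\frac12(f^+(r)+f^+(-r))$ with $f^+(x)=\max\{0,f(x)\}$; $n(t,f)=\sum_{|s|\le t,\ \omega_f(s)<0}|\omega_f(s)|$; $N(r,f)=\frac12\int_0^r n(t,f)\,dt$. Thus $N(r,1_\circ\oslash f)=N(r,-f)$ counts the roots of $f$. Gondran-Minoux independence: $g_0,\ldots,g_n$ are linearly dependent in the Gondran-Minoux sense if there exist disjoint $I,J$ with $I\cup J=\{0,\ldots,n\}$ and constants $\alpha_0,\ldots,\alpha_n\in\mathbb{R}_{\max}$, not all $-\infty$, such that $\max_{i\in I}\{\alpha_i+g_i\}=\max_{j\in J}\{\alpha_j+g_j\}$ identically (an empty maximum being $-\infty$); otherwise they are linearly independent. Tropical linear combination of $g_0,\ldots,g_n$ over $\mathbb{R}_{\max}$: a function $\max_{0\le i\le n}\{a_i+g_i\}$ with $a_i\in\mathbb{R}_{\max}$, at least one $a_i$ being real. For such an $f$, let $\ell(f)$ be the least $j\in\{1,\ldots,n+1\}$ such that $f=\max_{1\le i\le j}\{a_{k_i}+g_{k_i}\}$ for some indices $0\le k_1<\cdots<k_j\le n$ and real $a_{k_i}$. For a set $Q$ of tropical linear combinations of $g_0,\ldots,g_n$, the degree of degeneracy is $\mathrm{ddg}(Q)=\mathrm{card}(\{f\in Q:\ell(f)<n+1\})$. Tropical Casoratian: $C_\circ(f_0,\ldots,f_n)(x)=\max_\pi\sum_{j=0}^n f_j(x+\pi(j))$, the maximum being over all permutations $\pi$ of $\{0,\ldots,n\}$. Tropical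 projective space: $\mathbb{TP}^n$ is the quotient of $\mathbb{R}_{\max}^{n+1}\setminus\{(-\infty,\ldots,-\infty)\}$ by $(a_0,\ldots,a_n)\sim(\lambda+a_0,\ldots,\lambda+a_n)$, $\lambda\in\mathbb{R}$. A tropical holomorphic curve is a map $g=[g_0:\cdots:g_n]:\mathbb{R}\to\mathbb{TP}^n$ with $g_j$ tropical entire having no root common to all of them; $(g_0,\ldots,g_n)$ is then a reduced representation of $g$. Its tropical Cartan characteristic is $T_g(r)=\frac12(F(r)+F(-r))-F(0)$, where $F(x)=\max\{g_0(x),\ldots,g_n(x)\}$.
   Formalization: The inequality is claimed for all sufficiently large r, and for every r>0 if each f_ν (ν>n) with all coefficients real has ℓ(f_ν)=n+1; λ counts degenerate f_ν by index, with repetitions. Read literally (all r, λ counted on the set) the claim fails. *)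

theory Defs
  imports "HOL-Analysis.Analysis"
begin

definition locally_affine :: "(real \<Rightarrow> real) \<Rightarrow> real \<Rightarrow> bool" where
  "locally_affine f x \<longleftrightarrow> (\<exists>c d. \<forall>\<^sub>F y in nhds x. f y = c * y + d)"

definition tropical_meromorphic :: "(real \<Rightarrow> real) \<Rightarrow> bool" where
  "tropical_meromorphic f \<longleftrightarrow>
     continuous_on UNIV f \<and> (\<forall>x. \<not> x islimpt {s. \<not> locally_affine f s})"

definition slope_jump :: "(real \<Rightarrow> real) \<Rightarrow> real \<Rightarrow> real" where
  "slope_jump f x = Lim (at_right 0) (\<lambda>e. deriv f (x + e) - deriv f (x - e))"

definition is_trop_pole :: "(real \<Rightarrow> real) \<Rightarrow> real \<Rightarrow> bool" where
  "is_trop_pole f x \<longleftrightarrow> slope_jump f x < 0"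

definition is_trop_root :: "(real \<Rightarrow> real) \<Rightarrow> real \<Rightarrow> bool" where
  "is_trop_root f x \<longleftrightarrow> slope_jump f x > 0"

definition tropical_entire :: "(real \<Rightarrow> real) \<Rightarrow> bool" where
  "tropical_entire f \<longleftrightarrow> tropical_meromorphic f \<and> (\<forall>x. \<not> is_trop_pole f x)"

text \<open>Nevanlinna's functions: proximity \<open>m(r,f)\<close>, unintegrated counting \<open>n(t,f)\<close>
  and integrated counting \<open>N(r,f)\<close> of the poles.\<close>

definition nev_m :: "real \<Rightarrow> (real \<Rightarrow> real) \<Rightarrow> real" where
  "nev_m r f = (max 0 (f r) + max 0 (f (- r))) / 2"

definition nev_n :: "real \<Rightarrow> (real \<Rightarrow> real) \<Rightarrow> real" where
  "nev_n t f = (\<Sum>s | \<bar>s\<bar> \<le> t \<and> is_trop_pole f s. \<bar>slope_jump f s\<bar>)"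

definition nev_N :: "real \<Rightarrow> (real \<Rightarrow> real) \<Rightarrow> real" where
  "nev_N r f = integral {0..r} (\<lambda>t. nev_n t f) / 2"

text \<open>The tropical semiring is the set of extended reals without \<open>\<infinity>\<close>; on it, \<open>+\<close> of
  extended reals is the tropical product.\<close>

definition Rmax :: "ereal set" where
  "Rmax = {a. a \<noteq> \<infinity>}"

text \<open>For finite \<open>I\<close> the supremum is a maximum, and it is \<open>-\<infinity>\<close> for empty \<open>I\<close>.\<close>

definition trop_max :: "nat set \<Rightarrow> (nat \<Rightarrow> ereal) \<Rightarrow> (nat \<Rightarrow> real \<Rightarrow> real) \<Rightarrow> real \<Rightarrow> ereal" where
  "trop_max I \<alpha> g x = (SUP i\<in>I. \<alpha> i + ereal (g i x))"

definition gm_dependent :: "nat \<Rightarrow> (nat \<Rightarrow> real \<Rightarrow> real) \<Rightarrow> bool" where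
  "gm_dependent n g \<longleftrightarrow>
     (\<exists>I J \<alpha>. I \<inter> J = {} \<and> I \<union> J = {0..n} \<and>
        (\<forall>i\<in>{0..n}. \<alpha> i \<in> Rmax) \<and> (\<exists>i\<in>{0..n}. \<alpha> i \<noteq> -\<infinity>) \<and>
        (\<forall>x. trop_max I \<alpha> g x = trop_max J \<alpha> g x))"

definition gm_independent :: "nat \<Rightarrow> (nat \<Rightarrow> real \<Rightarrow> real) \<Rightarrow> bool" where
  "gm_independent n g \<longleftrightarrow> \<not> gm_dependent n g"

text \<open>The shortest length \<open>\<ell>(f)\<close> of a representation of a tropical linear combination \<open>f\<close> of
  \<open>g\<^sub>0, \<dots>, g\<^sub>n\<close>; \<open>K\<close> is the set of the indices \<open>k\<^sub>1 < \<dots> < k\<^sub>j\<close>.\<close>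

definition shortest_length :: "nat \<Rightarrow> (nat \<Rightarrow> real \<Rightarrow> real) \<Rightarrow> (real \<Rightarrow> real) \<Rightarrow> nat" where
  "shortest_length n g f =
     (LEAST j. j \<in> {1..n + 1} \<and>
        (\<exists>K \<beta>. K \<subseteq> {0..n} \<and> card K = j \<and>
           (\<forall>x. f x = Max ((\<lambda>k. \<beta> k + g k x) ` K))))"

definition ddg :: "nat \<Rightarrow> (nat \<Rightarrow> real \<Rightarrow> real) \<Rightarrow> (real \<Rightarrow> real) set \<Rightarrow> nat" where
  "ddg n g Q = card {f \<in> Q. shortest_length n g f < n + 1}"

text \<open>Degree of degeneracy of an indexed collection \<open>(f\<^sub>\<nu>)\<close>, \<open>\<nu> \<in> S\<close>. Equal members at
  different indices are counted separately, in keeping with estimates that sum over \<open>\<nu>\<close>.\<close>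

definition ddg_family ::
  "nat \<Rightarrow> (nat \<Rightarrow> real \<Rightarrow> real) \<Rightarrow> nat set \<Rightarrow> (nat \<Rightarrow> real \<Rightarrow> real) \<Rightarrow> nat" where
  "ddg_family n g S f = card {\<nu> \<in> S. shortest_length n g (f \<nu>) < n + 1}"

lemma ddg_family_eq_ddg:
  assumes "inj_on f S"
  shows "ddg_family n g S f = ddg n g (f ` S)"
proof -
  have "{h \<in> f ` S. shortest_length n g h < n + 1}
        = f ` {\<nu> \<in> S. shortest_length n g (f \<nu>) < n + 1}"
    by auto
  moreover have "inj_on f {\<nu> \<in> S. shortest_length n g (f \<nu>) < n + 1}"
    using assms by (rule inj_on_subset) auto
  ultimately show ?thesis
    by (simp add: ddg_def ddg_family_def card_image)
qed

definition trop_casoratian :: "nat \<Rightarrow> (nat \<Rightarrow> real \<Rightarrow> real) \<Rightarrow> real \<Rightarrow> real" where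
  "trop_casoratian n f x =
     Max ((\<lambda>p. \<Sum>j=0..n. f j (x + real (p j))) ` {p. p permutes {0..n}})"

text \<open>Points of tropical projective \<open>n\<close>-space are classes of vectors indexed by \<open>{0..n}\<close>,
  extended by \<open>-\<infinity>\<close> to all indices.\<close>

definition trop_vectors :: "nat \<Rightarrow> (nat \<Rightarrow> ereal) set" where
  "trop_vectors n =
     {v. (\<forall>i\<le>n. v i \<in> Rmax) \<and> (\<exists>i\<le>n. v i \<noteq> -\<infinity>) \<and> (\<forall>i>n. v i = -\<infinity>)}"

definition trop_proportional :: "nat \<Rightarrow> ((nat \<Rightarrow> ereal) \<times> (nat \<Rightarrow> ereal)) set" where
  "trop_proportional n =
     {(v, w). v \<in> trop_vectors n \<and> w \<in> trop_vectors n \<and>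
        (\<exists>c::real. \<forall>i\<le>n. w i = ereal c + v i)}"

definition trop_proj_space :: "nat \<Rightarrow> (nat \<Rightarrow> ereal) set set" where
  "trop_proj_space n = trop_vectors n // trop_proportional n"

definition trop_proj_point :: "nat \<Rightarrow> (nat \<Rightarrow> real) \<Rightarrow> (nat \<Rightarrow> ereal) set" where
  "trop_proj_point n v =
     trop_proportional n `` {\<lambda>i. if i \<le> n then ereal (v i) else -\<infinity>}"

lemma trop_proj_point_in_space: "trop_proj_point n v \<in> trop_proj_space n"
  unfolding trop_proj_point_def trop_proj_space_def
  by (rule quotientI) (auto simp: trop_vectors_def Rmax_def)

definition no_common_root :: "nat \<Rightarrow> (nat \<Rightarrow> real \<Rightarrow> real) \<Rightarrow> bool" where
  "no_common_root n g \<longleftrightarrow> \<not> (\<exists>x. \<forall>j\<le>n. is_trop_root (g j) x)"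

definition reduced_representation ::
  "nat \<Rightarrow> (real \<Rightarrow> (nat \<Rightarrow> ereal) set) \<Rightarrow> (nat \<Rightarrow> real \<Rightarrow> real) \<Rightarrow> bool" where
  "reduced_representation n G g \<longleftrightarrow>
     (\<forall>j\<le>n. tropical_entire (g j)) \<and> no_common_root n g \<and>
     (\<forall>x. G x = trop_proj_point n (\<lambda>j. g j x))"

text \<open>The Cartan characteristic of the curve with reduced representation \<open>g\<close>.\<close>

definition cartan_characteristic :: "nat \<Rightarrow> (nat \<Rightarrow> real \<Rightarrow> real) \<Rightarrow> real \<Rightarrow> real" where
  "cartan_characteristic n g r =
     (let F = (\<lambda>x. Max ((\<lambda>j. g j x) ` {0..n})) in (F r + F (- r)) / 2 - F 0)"

end

theory Submission
  imports Defs
begin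

text \<open>
  A continuous piecewise linear function \<open>h\<close> with slope jumps \<open>\<omega>\<^sub>s\<close> satisfies the tropical
  Jensen formula \<open>N(r,-h) - N(r,h) = (h(r) + h(-r))/2 - h(0)\<close>, because on \<open>[-r,r]\<close> it is an
  affine function plus \<open>\<Sum>\<^sub>s \<omega>\<^sub>s max(0, x - s)\<close>, and both sides are linear in \<open>h\<close>, vanish on
  affine functions and equal \<open>(r - \<bar>s\<bar>)/2\<close> on one such hinge (\<open>tropical_jensen\<close>).

  Apply it to \<open>L\<^sub>t\<close>. The sum of the differences \<open>f\<^sub>j(j) - f\<^sub>j(0)\<close> in the claim is
  \<open>L\<^sub>t(0) - L(0)\<close>, so the right-hand side starts with \<open>(L\<^sub>t(r) + L\<^sub>t(-r))/2\<close>. In the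
  Casoratian, replacing the diagonal term \<open>\<Sum>\<^sub>j f\<^sub>j(x+j)\<close> by the term of a permutation \<open>\<pi>\<close> costs
  \<open>\<Sum>\<^sub>j ((f\<^sub>j - f\<^sub>0)(x + \<pi>(j)) - (f\<^sub>j - f\<^sub>0)(x + j))\<close>, since \<open>\<Sum>\<^sub>j f\<^sub>0(x + \<pi>(j))\<close> does not depend
  on \<open>\<pi>\<close>; this is at most the sum of the functions whose means are the proximity terms
  (\<open>trop_casoratian_le\<close>). What remains to be bounded below is the sum over \<open>\<nu> > n\<close> of the means
  \<open>(f\<^sub>\<nu>(r) + f\<^sub>\<nu>(-r))/2\<close>, one \<open>\<nu>\<close> at a time.

  If all coefficients of \<open>f\<^sub>\<nu>\<close> are real, then \<open>f\<^sub>\<nu> \<ge> F + min\<^sub>j a\<^sub>j\<^sub>\<nu>\<close> with \<open>F = max\<^sub>j g\<^sub>j\<close>, which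
  contributes one copy of the mean of \<open>F\<close>. Otherwise \<open>f\<^sub>\<nu>\<close> is degenerate, so no copy is asked
  for, and midpoint convexity gives \<open>f\<^sub>\<nu>(0)\<close>. The delicate case is a degenerate \<open>f\<^sub>\<nu>\<close> with real
  coefficients: the superfluous mean of \<open>F\<close> can be dropped only where it is nonnegative, and
  this is why \<open>r\<close> may have to be large. For large \<open>r\<close> it is nonnegative because independence forces \<open>F(r) + F(-r) \<rightarrow> \<infinity>\<close>: either
  some \<open>g\<^sub>j\<close> has a kink, and beyond it \<open>g\<^sub>j(r) + g\<^sub>j(-r)\<close> grows at least linearly, or all \<open>g\<^sub>j\<close>
  are affine, and two of them have different slopes (\<open>eventually_symmetric_sum_ge\<close>).
\<close>

section \<open>One-sided slopes of piecewise affine functions\<close>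

text \<open>Near each point of \<open>A\<close> the slope and the intercept are locally constant, so connectedness
  makes them constant on \<open>A\<close>.\<close>
lemma locally_affine_imp_affine_on:
  assumes "connected A" and affine: "\<And>x. x \<in> A \<Longrightarrow> locally_affine h x"
  shows "\<exists>c d. \<forall>x\<in>A. h x = c * x + d"
proof -
  \<comment> \<open>slope and intercept of the affine function that \<open>h\<close> is near \<open>x\<close>\<close>
  define k where "k = (\<lambda>x. (deriv h x, h x - deriv h x * x))"
  have loc: "\<exists>T. open T \<and> x \<in> T \<and> (\<forall>y\<in>T. k y = k x)" if x: "x \<in> A" for x
  proof -
    obtain c d where "\<forall>\<^sub>F y in nhds x. h y = c * y + d"
      using affine[OF x] unfolding locally_affine_def by blast
    then obtain T where T: "open T" "x \<in> T" "\<And>y. y \<in> T \<Longrightarrow> h y = c * y + d"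
      unfolding eventually_nhds by blast
    have "deriv h y = c" if "y \<in> T" for y
    proof (rule DERIV_imp_deriv)
      have "((\<lambda>y. c * y + d) has_field_derivative c) (at y)"
        by (auto intro!: derivative_eq_intros)
      then show "(h has_field_derivative c) (at y)"
        by (rule has_field_derivative_transform_within_open[OF _ T(1) that]) (use T(3) in simp)
    qed
    then have "k y = k x" if "y \<in> T" for y
      using T that by (simp add: k_def)
    with T show ?thesis by blast
  qed
  have "k constant_on A"
    by (rule locally_constant_imp_constant[OF assms(1)])
       (use loc in \<open>metis openin_open_Int open_openin openin_subtopology_self IntE IntI\<close>)
  then obtain p where "\<And>x. x \<in> A \<Longrightarrow> k x = p"
    unfolding constant_on_def by blast
  then have "h x = fst p * x + snd p" if "x \<in> A" for x
    using that by (force simp: k_def)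
  then show ?thesis by blast
qed

text \<open>For the filters \<open>at_right x\<close> and \<open>at_left x\<close>, this says that \<open>h\<close> coincides with an
  affine function of slope \<open>c\<close> on a one-sided neighbourhood of \<open>x\<close>. Continuity at \<open>x\<close> is built
  in, since that function takes the value \<open>h x\<close> at \<open>x\<close>.\<close>
definition slope_along :: "real filter \<Rightarrow> (real \<Rightarrow> real) \<Rightarrow> real \<Rightarrow> real \<Rightarrow> bool" where
  "slope_along F h x c \<longleftrightarrow> (\<forall>\<^sub>F y in F. h y = h x + c * (y - x))"

text \<open>This pointwise form of tropical meromorphy makes closure under the tropical operations
  a computation with one-sided slopes. Accumulation of kinks is excluded because each point has
  affine pieces of positive length on both sides (\<open>finite_kinks\<close>).\<close>
definition piecewise_affine :: "(real \<Rightarrow> real) \<Rightarrow> bool" where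
  "piecewise_affine h \<longleftrightarrow>
     (\<forall>x. (\<exists>c. slope_along (at_right x) h x c) \<and> (\<exists>c. slope_along (at_left x) h x c))"

lemma slope_along_add:
  "slope_along F h x c \<Longrightarrow> slope_along F k x d \<Longrightarrow> slope_along F (\<lambda>y. h y + k y) x (c + d)"
  unfolding slope_along_def by (erule (1) eventually_elim2) (simp add: algebra_simps)

lemma slope_along_cmult:
  "slope_along F h x c \<Longrightarrow> slope_along F (\<lambda>y. b * h y) x (b * c)"
  unfolding slope_along_def by (erule eventually_mono) (metis distrib_left mult.assoc)

lemma slope_along_uminus:
  "slope_along F h x c \<Longrightarrow> slope_along F (\<lambda>y. - h y) x (- c)"
  using slope_along_cmult[of F h x c "-1"] by simp

lemma slope_along_const: "slope_along F (\<lambda>_. b) x 0"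
  by (simp add: slope_along_def)

lemma slope_along_max_aux:
  fixes x :: real
  assumes "F \<le> nhds x" "slope_along F h x c" "slope_along F k x d" "h x > k x"
  shows "slope_along F (\<lambda>y. max (h y) (k y)) x c"
proof -
  have "((\<lambda>y. (h x + c * (y - x)) - (k x + d * (y - x)))
          \<longlongrightarrow> (h x + c * (x - x)) - (k x + d * (x - x))) (nhds x)"
    by (intro tendsto_intros filterlim_ident)
  then have "((\<lambda>y. (h x + c * (y - x)) - (k x + d * (y - x))) \<longlongrightarrow> h x - k x) F"
    using tendsto_mono[OF assms(1)] by simp
  then have "\<forall>\<^sub>F y in F. 0 < (h x + c * (y - x)) - (k x + d * (y - x))"
    using assms(4) by (intro order_tendstoD) auto
  then show ?thesis
    using assms(2,3) unfolding slope_along_def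
    by eventually_elim (use assms(4) in auto)
qed

text \<open>Where \<open>h\<close> and \<open>k\<close> meet, the steeper one is the maximum to the right and the flatter one is
  the maximum to the left; elsewhere the larger one wins near \<open>x\<close>.\<close>
lemma slope_along_max:
  fixes x :: real
  assumes F: "F = at_right x \<or> F = at_left x"
    and "slope_along F h x c" "slope_along F k x d"
  shows "\<exists>b. slope_along F (\<lambda>y. max (h y) (k y)) x b"
proof -
  have nhds: "F \<le> nhds x"
    using F by (auto simp: at_within_def)
  consider "h x > k x" | "k x > h x" | "h x = k x" by linarith
  then show ?thesis
  proof cases
    case 1
    then show ?thesis using slope_along_max_aux[OF nhds assms(2,3)] by blast
  next
    case 2
    then show ?thesis using slope_along_max_aux[OF nhds assms(3,2)] by (auto simp: max.commute)
  next
    case 3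
    from F show ?thesis
    proof
      assume R: "F = at_right x"
      have "\<forall>\<^sub>F y in F. y > x" unfolding R by (rule eventually_at_right_less)
      then have "slope_along F (\<lambda>y. max (h y) (k y)) x (max c d)"
        using assms(2,3) unfolding slope_along_def
        by eventually_elim (use 3 in \<open>auto simp: max_def mult_le_cancel_right\<close>)
      then show ?thesis ..
    next
      assume L: "F = at_left x"
      have "\<forall>\<^sub>F y in F. y < x" unfolding L by (simp add: eventually_at_filter)
      then have "slope_along F (\<lambda>y. max (h y) (k y)) x (min c d)"
        using assms(2,3) unfolding slope_along_def
        by eventually_elim (use 3 in \<open>auto simp: max_def min_def mult_le_cancel_right\<close>)
      then show ?thesis ..
    qed
  qed
qed

lemma piecewise_affine_slopes:
  assumes "piecewise_affine h"
  obtains c d where "slope_along (at_right x) h x c" "slope_along (at_left x) h x d"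
  using assms unfolding piecewise_affine_def by blast

lemma piecewise_affine_add:
  "piecewise_affine h \<Longrightarrow> piecewise_affine k \<Longrightarrow> piecewise_affine (\<lambda>y. h y + k y)"
  unfolding piecewise_affine_def by (blast intro: slope_along_add)

lemma piecewise_affine_cmult:
  "piecewise_affine h \<Longrightarrow> piecewise_affine (\<lambda>y. b * h y)"
  unfolding piecewise_affine_def by (blast intro: slope_along_cmult)

lemma piecewise_affine_uminus:
  "piecewise_affine h \<Longrightarrow> piecewise_affine (\<lambda>y. - h y)"
  unfolding piecewise_affine_def by (blast intro: slope_along_uminus)

lemma piecewise_affine_const: "piecewise_affine (\<lambda>_. b)"
  unfolding piecewise_affine_def by (blast intro: slope_along_const)

lemma piecewise_affine_sum:
  "(\<And>i. i \<in> A \<Longrightarrow> piecewise_affine (h i)) \<Longrightarrow> piecewise_affine (\<lambda>y. \<Sum>i\<in>A. h i y)"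
  by (induction A rule: infinite_finite_induct)
     (auto simp: piecewise_affine_const intro: piecewise_affine_add)

lemma piecewise_affine_max:
  "piecewise_affine h \<Longrightarrow> piecewise_affine k \<Longrightarrow> piecewise_affine (\<lambda>y. max (h y) (k y))"
  unfolding piecewise_affine_def by (blast intro: slope_along_max)

lemma piecewise_affine_Max:
  assumes "finite A" "A \<noteq> {}" "\<And>i. i \<in> A \<Longrightarrow> piecewise_affine (h i)"
  shows "piecewise_affine (\<lambda>y. Max ((\<lambda>i. h i y) ` A))"
  using assms
proof (induction A rule: finite_ne_induct)
  case (insert i A)
  then have "piecewise_affine (\<lambda>y. max (h i y) (Max ((\<lambda>i. h i y) ` A)))"
    by (intro piecewise_affine_max) auto
  with insert show ?case by simp
qed simp

lemma piecewise_affine_shift: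
  assumes "piecewise_affine h"
  shows "piecewise_affine (\<lambda>y. h (y + s))"
  unfolding piecewise_affine_def
proof
  fix x
  obtain c d where c: "slope_along (at_right (x + s)) h (x + s) c"
    and d: "slope_along (at_left (x + s)) h (x + s) d"
    using piecewise_affine_slopes[OF assms] by blast
  have "slope_along (at_right x) (\<lambda>y. h (y + s)) x c"
    using c unfolding slope_along_def eventually_at_right_field
    by (metis add_diff_cancel_right add_less_cancel_right diff_add_cancel)
  moreover have "slope_along (at_left x) (\<lambda>y. h (y + s)) x d"
    using d unfolding slope_along_def eventually_at_left_field
    by (metis add_diff_cancel_right add_less_cancel_right diff_add_cancel)
  ultimately show "(\<exists>c. slope_along (at_right x) (\<lambda>y. h (y + s)) x c) \<and>
      (\<exists>c. slope_along (at_left x) (\<lambda>y. h (y + s)) x c)"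
    by blast
qed

section \<open>Slope jumps\<close>
lemma slope_jump_eq:
  assumes "slope_along (at_right x) h x c" "slope_along (at_left x) h x d"
  shows "slope_jump h x = c - d"
proof -
  obtain u where u: "u > x" "\<And>y. x < y \<Longrightarrow> y < u \<Longrightarrow> h y = h x + c * (y - x)"
    using assms(1) unfolding slope_along_def eventually_at_right_field by blast
  obtain l where l: "l < x" "\<And>y. l < y \<Longrightarrow> y < x \<Longrightarrow> h y = h x + d * (y - x)"
    using assms(2) unfolding slope_along_def eventually_at_left_field by blast
  have affine: "((\<lambda>y. h x + b * (y - x)) has_field_derivative b) (at z)" for b z
    by (auto intro!: derivative_eq_intros)
  have "deriv h y = c" if "x < y" "y < u" for y
    by (rule DERIV_imp_deriv, rule has_field_derivative_transform_within_open[OF affine, of "{x<..<u}"])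
       (use u that in auto)
  moreover have "deriv h y = d" if "l < y" "y < x" for y
    by (rule DERIV_imp_deriv, rule has_field_derivative_transform_within_open[OF affine, of "{l<..<x}"])
       (use l that in auto)
  ultimately have "\<forall>\<^sub>F e in at_right 0. deriv h (x + e) - deriv h (x - e) = c - d"
    unfolding eventually_at_right_field
    by (intro exI[of _ "min (u - x) (x - l)"]) (use u(1) l(1) in auto)
  then show ?thesis
    unfolding slope_jump_def by (intro tendsto_Lim tendsto_eventually) auto
qed

lemma slope_jump_add:
  assumes "piecewise_affine h" "piecewise_affine k"
  shows "slope_jump (\<lambda>y. h y + k y) x = slope_jump h x + slope_jump k x"
proof -
  obtain a b c d where "slope_along (at_right x) h x a" "slope_along (at_left x) h x b"
    "slope_along (at_right x) k x c" "slope_along (at_left x) k x d"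
    by (meson assms piecewise_affine_slopes)
  then show ?thesis
    using slope_jump_eq[OF slope_along_add slope_along_add, of x h a k c b d]
    by (simp add: slope_jump_eq)
qed

lemma slope_jump_cmult:
  assumes "piecewise_affine h"
  shows "slope_jump (\<lambda>y. b * h y) x = b * slope_jump h x"
proof -
  obtain c d where cd: "slope_along (at_right x) h x c" "slope_along (at_left x) h x d"
    by (meson assms piecewise_affine_slopes)
  from slope_jump_eq[OF slope_along_cmult slope_along_cmult, OF cd, of b] slope_jump_eq[OF cd]
  show ?thesis by (simp add: right_diff_distrib)
qed

lemma slope_jump_uminus:
  assumes "piecewise_affine h"
  shows "slope_jump (\<lambda>y. - h y) x = - slope_jump h x"
  using slope_jump_cmult[OF assms, of "-1"] by simp

lemma slope_jump_sum:
  assumes "finite A" "\<And>i. i \<in> A \<Longrightarrow> piecewise_affine (h i)"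
  shows "slope_jump (\<lambda>y. \<Sum>i\<in>A. h i y) x = (\<Sum>i\<in>A. slope_jump (h i) x)"
  using assms
proof (induction A rule: finite_induct)
  case empty
  then show ?case
    using slope_jump_eq[OF slope_along_const slope_along_const] by simp
next
  case (insert i A)
  then show ?case
    by (simp add: slope_jump_add piecewise_affine_sum)
qed

lemma locally_affine_iff_slope_jump:
  assumes "piecewise_affine h"
  shows "locally_affine h x \<longleftrightarrow> slope_jump h x = 0"
proof
  assume "locally_affine h x"
  then obtain c d where ev: "\<forall>\<^sub>F y in nhds x. h y = c * y + d"
    unfolding locally_affine_def by blast
  then have x: "h x = c * x + d" by (rule eventually_nhds_x_imp_x)
  have "slope_along (at_right x) h x c" "slope_along (at_left x) h x c"
    unfolding slope_along_def at_within_def eventually_inf_principal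
    by (rule eventually_mono[OF ev]; simp add: x algebra_simps)+
  then show "slope_jump h x = 0" by (simp add: slope_jump_eq)
next
  assume 0: "slope_jump h x = 0"
  obtain c d where cd: "slope_along (at_right x) h x c" "slope_along (at_left x) h x d"
    by (meson assms piecewise_affine_slopes)
  with 0 have "c = d" by (simp add: slope_jump_eq)
  with cd have "\<forall>\<^sub>F y in at x. h y = h x + c * (y - x)"
    by (simp add: slope_along_def eventually_at_split)
  then have "\<forall>\<^sub>F y in nhds x. h y = c * y + (h x - c * x)"
    unfolding eventually_at_filter by (rule eventually_mono) (auto simp: algebra_simps)
  then show "locally_affine h x"
    unfolding locally_affine_def by blast
qed

text \<open>All points sufficiently near \<open>x\<close>, except perhaps \<open>x\<close> itself, lie inside one of the two
  affine pieces at \<open>x\<close>. So kinks do not accumulate, and a compact interval contains finitely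
  many.\<close>
lemma finite_kinks:
  assumes "piecewise_affine h"
  shows "finite {s. \<bar>s\<bar> \<le> r \<and> slope_jump h s \<noteq> 0}"
proof -
  have "\<not> x islimpt {s. slope_jump h s \<noteq> 0}" for x
  proof -
    obtain c d where cd: "slope_along (at_right x) h x c" "slope_along (at_left x) h x d"
      by (meson assms piecewise_affine_slopes)
    obtain u where u: "u > x" "\<And>y. x < y \<Longrightarrow> y < u \<Longrightarrow> h y = h x + c * (y - x)"
      using cd(1) unfolding slope_along_def eventually_at_right_field by blast
    obtain l where l: "l < x" "\<And>y. l < y \<Longrightarrow> y < x \<Longrightarrow> h y = h x + d * (y - x)"
      using cd(2) unfolding slope_along_def eventually_at_left_field by blast
    have "locally_affine h y" if "l < y" "y < u" "y \<noteq> x" for y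
    proof (cases "y < x")
      case True
      have "\<forall>\<^sub>F z in nhds y. z \<in> {l<..<x}"
        using that True by (intro eventually_nhds_in_open) auto
      then have "\<forall>\<^sub>F z in nhds y. h z = d * z + (h x - d * x)"
        by (rule eventually_mono) (use l in \<open>auto simp: algebra_simps\<close>)
      then show ?thesis unfolding locally_affine_def by blast
    next
      case False
      have "\<forall>\<^sub>F z in nhds y. z \<in> {x<..<u}"
        using that False by (intro eventually_nhds_in_open) auto
      then have "\<forall>\<^sub>F z in nhds y. h z = c * z + (h x - c * x)"
        by (rule eventually_mono) (use u in \<open>auto simp: algebra_simps\<close>)
      then show ?thesis unfolding locally_affine_def by blast
    qed
    then have no: "slope_jump h y = 0" if "y \<in> {l<..<u}" "y \<noteq> x" for y
      using that locally_affine_iff_slope_jump[OF assms] by simp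
    show ?thesis
      unfolding islimpt_def
      by (intro notI, drule spec[of _ "{l<..<u}"]) (use no u(1) l(1) in auto)
  qed
  then have "finite ({-r..r} \<inter> {s. slope_jump h s \<noteq> 0})"
    by (intro finite_not_islimpt_in_compact) auto
  moreover have "{s. \<bar>s\<bar> \<le> r \<and> slope_jump h s \<noteq> 0} = {-r..r} \<inter> {s. slope_jump h s \<noteq> 0}"
    by (auto simp: abs_le_iff)
  ultimately show ?thesis by simp
qed

lemma slope_along_by_continuity:
  assumes "isCont h x" "F \<le> at x" "F \<noteq> bot" "\<forall>\<^sub>F y in F. h y = c * y + d"
  shows "slope_along F h x c"
proof -
  have "(h \<longlongrightarrow> h x) F"
    using assms(1,2) unfolding isCont_def by (metis tendsto_mono)
  moreover have "((\<lambda>y. c * y + d) \<longlongrightarrow> c * x + d) F"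
    using tendsto_mono[OF assms(2)] by (auto intro!: tendsto_intros)
  then have "(h \<longlongrightarrow> c * x + d) F"
    by (rule Lim_transform_eventually) (use assms(4) in \<open>auto elim: eventually_mono\<close>)
  ultimately have "h x = c * x + d"
    using tendsto_unique[OF assms(3)] by blast
  then show ?thesis
    unfolding slope_along_def by (intro eventually_mono[OF assms(4)]) (simp add: algebra_simps)
qed

text \<open>Next to \<open>x\<close> there is an interval without kinks on either side, on which \<open>h\<close> is affine;
  continuity fixes the value of this affine function at \<open>x\<close>.\<close>
lemma tropical_meromorphic_imp_piecewise_affine:
  assumes "tropical_meromorphic h"
  shows "piecewise_affine h"
  unfolding piecewise_affine_def
proof (intro allI conjI)
  fix x
  have cont: "isCont h x"
    using assms by (simp add: tropical_meromorphic_def continuous_on_eq_continuous_at)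
  have "\<not> x islimpt {s. \<not> locally_affine h s}"
    using assms by (simp add: tropical_meromorphic_def)
  then obtain e where e: "e > 0" "\<And>y. y \<noteq> x \<Longrightarrow> dist y x < e \<Longrightarrow> locally_affine h y"
    unfolding islimpt_approachable by auto
  obtain c d where "\<forall>y\<in>{x<..<x+e}. h y = c * y + d"
    using locally_affine_imp_affine_on[of "{x<..<x+e}" h] e(2)
    by (auto simp: dist_real_def)
  then have "\<forall>\<^sub>F y in at_right x. h y = c * y + d"
    unfolding eventually_at_right_field using e(1) by (intro exI[of _ "x + e"]) auto
  then show "\<exists>c. slope_along (at_right x) h x c"
    by (intro exI[of _ c] slope_along_by_continuity[OF cont]) (auto simp: at_le)
  obtain c d where "\<forall>y\<in>{x-e<..<x}. h y = c * y + d"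
    using locally_affine_imp_affine_on[of "{x-e<..<x}" h] e(2)
    by (auto simp: dist_real_def)
  then have "\<forall>\<^sub>F y in at_left x. h y = c * y + d"
    unfolding eventually_at_left_field using e(1) by (intro exI[of _ "x - e"]) auto
  then show "\<exists>c. slope_along (at_left x) h x c"
    by (intro exI[of _ c] slope_along_by_continuity[OF cont]) (auto simp: at_le)
qed

section \<open>The tropical Jensen formula\<close>
lemma slope_jump_hinge:
  "piecewise_affine (\<lambda>y. max 0 (y - s))"
  "slope_jump (\<lambda>y. max 0 (y - s)) x = (if x = s then 1 else 0)"
proof -
  have right: "slope_along (at_right z) (\<lambda>y. max 0 (y - s)) z (if z < s then 0 else 1)" for z
    unfolding slope_along_def eventually_at_right_field
    by (intro exI[of _ "if z < s then s else z + 1"]) auto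
  have left: "slope_along (at_left z) (\<lambda>y. max 0 (y - s)) z (if z \<le> s then 0 else 1)" for z
    unfolding slope_along_def eventually_at_left_field
    by (intro exI[of _ "if z \<le> s then z - 1 else s"]) auto
  show "piecewise_affine (\<lambda>y. max 0 (y - s))"
    unfolding piecewise_affine_def using left right by blast
  show "slope_jump (\<lambda>y. max 0 (y - s)) x = (if x = s then 1 else 0)"
    using slope_jump_eq[OF right left] by auto
qed

text \<open>Subtracting the hinges leaves a function all of whose slope jumps in \<open>[-r,r]\<close> cancel,
  hence an affine one.\<close>
lemma piecewise_affine_representation:
  assumes "piecewise_affine h"
  obtains c d where "\<And>x. \<bar>x\<bar> \<le> r \<Longrightarrow>
    h x = c * x + d + (\<Sum>s | \<bar>s\<bar> \<le> r \<and> slope_jump h s \<noteq> 0. slope_jump h s * max 0 (x - s))"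
proof -
  define S where "S = {s. \<bar>s\<bar> \<le> r \<and> slope_jump h s \<noteq> 0}"
  have S: "finite S" unfolding S_def by (rule finite_kinks[OF assms])
  define B where "B = (\<lambda>x. \<Sum>s\<in>S. slope_jump h s * max 0 (x - s))"
  define k where "k = (\<lambda>x. h x + (- 1) * B x)"
  have pB: "piecewise_affine B"
    unfolding B_def by (intro piecewise_affine_sum piecewise_affine_cmult slope_jump_hinge)
  then have pk: "piecewise_affine k"
    unfolding k_def by (intro piecewise_affine_add piecewise_affine_cmult assms)
  have "slope_jump k x = 0" if "\<bar>x\<bar> \<le> r" for x
  proof -
    have "slope_jump B x = (\<Sum>s\<in>S. slope_jump h s * (if x = s then 1 else 0))"
      unfolding B_def
      by (simp add: slope_jump_sum[OF S] slope_jump_cmult slope_jump_hinge piecewise_affine_cmult)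
    also have "\<dots> = slope_jump h x"
      using S that by (auto simp: S_def if_distrib cong: if_cong)
    finally show ?thesis
      unfolding k_def slope_jump_add[OF assms piecewise_affine_cmult[OF pB]] slope_jump_cmult[OF pB]
      by simp
  qed
  then have "\<exists>c d. \<forall>x\<in>{-r..r}. k x = c * x + d"
    by (intro locally_affine_imp_affine_on)
       (auto simp: locally_affine_iff_slope_jump[OF pk] abs_le_iff)
  then obtain c d where "\<And>x. \<bar>x\<bar> \<le> r \<Longrightarrow> k x = c * x + d"
    by (auto simp: abs_le_iff)
  then show thesis
    using that[of c d] by (simp add: k_def B_def S_def algebra_simps)
qed

text \<open>The affine part has no symmetric second difference, and that of the hinge at \<open>s\<close> is the
  tent function \<open>r - \<bar>s\<bar>\<close>.\<close>
lemma symmetric_second_difference: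
  assumes "piecewise_affine h" "0 \<le> r"
  shows "h r + h (- r) - 2 * h 0
     = (\<Sum>s | \<bar>s\<bar> \<le> r \<and> slope_jump h s \<noteq> 0. slope_jump h s * (r - \<bar>s\<bar>))"
proof -
  define S where "S = {s. \<bar>s\<bar> \<le> r \<and> slope_jump h s \<noteq> 0}"
  obtain c d where rep: "\<And>x. \<bar>x\<bar> \<le> r \<Longrightarrow>
      h x = c * x + d + (\<Sum>s\<in>S. slope_jump h s * max 0 (x - s))"
    using piecewise_affine_representation[OF assms(1), of r] unfolding S_def by blast
  have "(h r + h (- r)) - 2 * h 0
      = (\<Sum>s\<in>S. slope_jump h s * (max 0 (r - s) + max 0 (- r - s) - 2 * max 0 (0 - s)))"
    using assms(2) by (simp add: rep sum.distrib sum_subtractf sum_distrib_left algebra_simps)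
  also have "\<dots> = (\<Sum>s\<in>S. slope_jump h s * (r - \<bar>s\<bar>))"
    by (rule sum.cong) (auto simp: S_def)
  finally show ?thesis unfolding S_def .
qed

text \<open>A pole \<open>s\<close> is counted for \<open>t\<close> from \<open>\<bar>s\<bar>\<close> to \<open>r\<close>, an interval of length \<open>r - \<bar>s\<bar>\<close>.\<close>
lemma nev_N_eq_sum:
  assumes "piecewise_affine h" "0 \<le> r"
  shows "nev_N r h = (\<Sum>s | \<bar>s\<bar> \<le> r \<and> slope_jump h s < 0. - slope_jump h s * (r - \<bar>s\<bar>)) / 2"
proof -
  define P where "P = {s. \<bar>s\<bar> \<le> r \<and> slope_jump h s < 0}"
  have P: "finite P"
    by (rule finite_subset[OF _ finite_kinks[OF assms(1), of r]]) (auto simp: P_def)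
  have n: "nev_n t h = (\<Sum>s\<in>P. if t \<in> {\<bar>s\<bar>..r} then - slope_jump h s else 0)" if "t \<in> {0..r}" for t
  proof -
    have "nev_n t h = (\<Sum>s\<in>{s \<in> P. t \<in> {\<bar>s\<bar>..r}}. - slope_jump h s)"
      unfolding nev_n_def by (rule sum.cong) (use that in \<open>auto simp: P_def is_trop_pole_def\<close>)
    then show ?thesis by (simp add: sum.inter_filter[OF P])
  qed
  have "((\<lambda>t. if t \<in> {\<bar>s\<bar>..r} then - slope_jump h s else 0) has_integral
      - slope_jump h s * (r - \<bar>s\<bar>)) {0..r}" if "s \<in> P" for s
  proof -
    have "((\<lambda>t. - slope_jump h s) has_integral (r - \<bar>s\<bar>) *\<^sub>R (- slope_jump h s)) {\<bar>s\<bar>..r}"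
      using has_integral_const_real[of "- slope_jump h s" "\<bar>s\<bar>" r] that by (simp add: P_def)
    then show ?thesis
      by (subst has_integral_restrict) (auto simp: mult.commute)
  qed
  then have "((\<lambda>t. \<Sum>s\<in>P. if t \<in> {\<bar>s\<bar>..r} then - slope_jump h s else 0) has_integral
      (\<Sum>s\<in>P. - slope_jump h s * (r - \<bar>s\<bar>))) {0..r}"
    by (intro has_integral_sum P)
  then have "((\<lambda>t. nev_n t h) has_integral (\<Sum>s\<in>P. - slope_jump h s * (r - \<bar>s\<bar>))) {0..r}"
    by (rule has_integral_eq[rotated]) (simp add: n)
  then show ?thesis
    unfolding nev_N_def P_def by (simp add: integral_unique)
qed

text \<open>Roots and poles enter the counting functions with opposite signs, so together they give
  the sum over all kinks in the symmetric second difference.\<close>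
lemma tropical_jensen:
  assumes "piecewise_affine h" "0 \<le> r"
  shows "nev_N r (\<lambda>x. - h x) - nev_N r h = (h r + h (- r)) / 2 - h 0"
proof -
  define S where "S = {s. \<bar>s\<bar> \<le> r \<and> slope_jump h s \<noteq> 0}"
  have S: "finite S" unfolding S_def by (rule finite_kinks[OF assms(1)])
  have root: "nev_N r (\<lambda>x. - h x)
      = (\<Sum>s | \<bar>s\<bar> \<le> r \<and> 0 < slope_jump h s. slope_jump h s * (r - \<bar>s\<bar>)) / 2"
    using nev_N_eq_sum[OF piecewise_affine_uminus[OF assms(1)] assms(2)]
    by (simp add: slope_jump_uminus[OF assms(1)])
  have split: "S = {s. \<bar>s\<bar> \<le> r \<and> 0 < slope_jump h s} \<union> {s. \<bar>s\<bar> \<le> r \<and> slope_jump h s < 0}"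
    by (auto simp: S_def)
  then have "(\<Sum>s\<in>S. slope_jump h s * (r - \<bar>s\<bar>))
    = (\<Sum>s | \<bar>s\<bar> \<le> r \<and> 0 < slope_jump h s. slope_jump h s * (r - \<bar>s\<bar>))
      + (\<Sum>s | \<bar>s\<bar> \<le> r \<and> slope_jump h s < 0. slope_jump h s * (r - \<bar>s\<bar>))"
    using S by (subst split, intro sum.union_disjoint) auto
  moreover have "h r + h (- r) - 2 * h 0 = (\<Sum>s\<in>S. slope_jump h s * (r - \<bar>s\<bar>))"
    unfolding S_def by (rule symmetric_second_difference[OF assms])
  ultimately show ?thesis
    unfolding root nev_N_eq_sum[OF assms] by (simp add: sum_negf) argo
qed


section \<open>Growth of independent entire functions\<close>

text \<open>When no jump is negative, the symmetric second difference is at least any one of its terms.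
  This serves both as a midpoint inequality, at \<open>s = r\<close>, and as linear growth in \<open>r\<close>, at a kink
  \<open>s\<close>.\<close>
lemma jump_contribution_le:
  assumes "piecewise_affine h" "\<And>s. 0 \<le> slope_jump h s" "\<bar>s\<bar> \<le> r"
  shows "2 * h 0 + slope_jump h s * (r - \<bar>s\<bar>) \<le> h r + h (- r)"
proof (cases "slope_jump h s = 0")
  case True
  have "0 \<le> (\<Sum>s | \<bar>s\<bar> \<le> r \<and> slope_jump h s \<noteq> 0. slope_jump h s * (r - \<bar>s\<bar>))"
    using assms(2) by (intro sum_nonneg) auto
  moreover have "0 \<le> r" using assms(3) by simp
  ultimately show ?thesis
    using symmetric_second_difference[OF assms(1), of r] True by simp
next
  case False
  have "slope_jump h s * (r - \<bar>s\<bar>)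
      \<le> (\<Sum>s | \<bar>s\<bar> \<le> r \<and> slope_jump h s \<noteq> 0. slope_jump h s * (r - \<bar>s\<bar>))"
    using assms False finite_kinks[OF assms(1), of r]
    by (intro member_le_sum[where f = "\<lambda>s. slope_jump h s * (r - \<bar>s\<bar>)"]) auto
  moreover have "0 \<le> r" using assms(3) by simp
  ultimately show ?thesis
    using symmetric_second_difference[OF assms(1), of r] by simp
qed

lemma midpoint_of_nonneg_jumps:
  assumes "piecewise_affine h" "\<And>s. 0 \<le> slope_jump h s" "0 \<le> r"
  shows "h 0 \<le> (h r + h (- r)) / 2"
  using jump_contribution_le[OF assms(1,2), of r r] assms(3) by simp

text \<open>A relation \<open>g\<^sub>i = b + g\<^sub>j\<close> is a Gondran-Minoux dependence in which all other coefficients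
  are \<open>-\<infinity>\<close>.\<close>
lemma gm_independent_imp_not_translate:
  assumes "gm_independent n g" "i \<le> n" "j \<le> n" "i \<noteq> j"
  shows "\<exists>x. g i x \<noteq> g j x + b"
proof (rule ccontr)
  assume "\<not> ?thesis"
  then have eq: "g i x = g j x + b" for x by simp
  define \<alpha> where "\<alpha> = (\<lambda>k. if k = i then 0 else if k = j then ereal b else -\<infinity>)"
  have "trop_max {i} \<alpha> g x = trop_max ({0..n} - {i}) \<alpha> g x" for x
  proof -
    have "trop_max ({0..n} - {i}) \<alpha> g x = ereal (g j x + b)"
      unfolding trop_max_def
    proof (rule antisym)
      show "(SUP k\<in>{0..n} - {i}. \<alpha> k + ereal (g k x)) \<le> ereal (g j x + b)"
        by (rule SUP_least) (auto simp: \<alpha>_def)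
      show "ereal (g j x + b) \<le> (SUP k\<in>{0..n} - {i}. \<alpha> k + ereal (g k x))"
        by (rule SUP_upper2[of j]) (use assms in \<open>auto simp: \<alpha>_def\<close>)
    qed
    then show ?thesis by (simp add: trop_max_def \<alpha>_def eq)
  qed
  moreover have "\<forall>k\<in>{0..n}. \<alpha> k \<in> Rmax" "\<exists>k\<in>{0..n}. \<alpha> k \<noteq> -\<infinity>"
    using assms(2) by (auto simp: \<alpha>_def Rmax_def)
  moreover have "{i} \<inter> ({0..n} - {i}) = {}" "{i} \<union> ({0..n} - {i}) = {0..n}"
    using assms(2) by auto
  ultimately have "gm_dependent n g"
    unfolding gm_dependent_def by blast
  then show False using assms(1) by (simp add: gm_independent_def)
qed

text \<open>The sum \<open>F(r) + F(-r)\<close> for \<open>F = max\<^sub>j g\<^sub>j\<close> grows at least linearly. A kink of one \<open>g\<^sub>j\<close>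
  suffices for this. Without kinks the \<open>g\<^sub>j\<close> are affine, and since \<open>g\<^sub>0\<close> and \<open>g\<^sub>1\<close> are not
  translates of each other their slopes differ; then \<open>g\<^sub>0\<close> at one end of \<open>[-r,r]\<close> together with
  \<open>g\<^sub>1\<close> at the other gives growth at the rate of the difference of the slopes.\<close>
lemma eventually_symmetric_sum_ge:
  assumes "0 < n" and pa: "\<And>j. j \<le> n \<Longrightarrow> piecewise_affine (g j)"
    and jump: "\<And>j s. j \<le> n \<Longrightarrow> 0 \<le> slope_jump (g j) s"
    and "gm_independent n g"
  shows "\<exists>r0\<ge>0. \<forall>r>r0. B \<le> Max ((\<lambda>j. g j r) ` {0..n}) + Max ((\<lambda>j. g j (- r)) ` {0..n})"
proof -
  define F where "F = (\<lambda>x. Max ((\<lambda>j. g j x) ` {0..n}))"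
  have F: "g j x \<le> F x" if "j \<le> n" for j x
    unfolding F_def using that by (intro Max_ge) auto
  have "\<exists>c>0. \<exists>d R. \<forall>r\<ge>R. c * r + d \<le> F r + F (- r)"
  proof (cases "\<exists>j\<le>n. \<exists>s. slope_jump (g j) s \<noteq> 0")
    case True
    then obtain j s where js: "j \<le> n" "slope_jump (g j) s \<noteq> 0" by blast
    define c where "c = slope_jump (g j) s"
    have "c > 0" using js jump[OF js(1), of s] by (simp add: c_def)
    moreover have "c * r + (2 * g j 0 - c * \<bar>s\<bar>) \<le> F r + F (- r)" if "r \<ge> \<bar>s\<bar>" for r
      using jump_contribution_le[OF pa jump that, of j, OF js(1) js(1)] F[OF js(1), of r] F[OF js(1), of "- r"]
      by (simp add: c_def algebra_simps)
    ultimately show ?thesis by blast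
  next
    case False
    have "\<exists>c d. \<forall>x. g j x = c * x + d" if "j \<le> n" for j
      using locally_affine_imp_affine_on[of UNIV "g j"] False that
      by (auto simp: locally_affine_iff_slope_jump[OF pa])
    then obtain c d where cd: "\<And>j x. j \<le> n \<Longrightarrow> g j x = c j * x + d j"
      by metis
    have "c 0 \<noteq> c 1"
      using gm_independent_imp_not_translate[OF assms(4), of 0 1 "d 0 - d 1"] assms(1)
      by (auto simp: cd)
    moreover have "\<bar>c 0 - c 1\<bar> * r + (d 0 + d 1) \<le> F r + F (- r)" for r
      using F[of 0 r] F[of 1 r] F[of 0 "- r"] F[of 1 "- r"] assms(1)
      by (simp add: cd abs_if algebra_simps)
    ultimately show ?thesis
      by (intro exI[of _ "\<bar>c 0 - c 1\<bar>"]) auto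
  qed
  then obtain c d R where c: "c > 0" and R: "\<And>r. r \<ge> R \<Longrightarrow> c * r + d \<le> F r + F (- r)"
    by blast
  have "B \<le> F r + F (- r)" if "r > max 0 (max R ((B - d) / c))" for r
  proof -
    have "B - d \<le> c * r" using that c by (simp add: field_simps)
    then show ?thesis using R[of r] that by simp
  qed
  then show ?thesis
    unfolding F_def by (intro exI[of _ "max 0 (max R ((B - d) / c))"]) auto
qed

section \<open>Tropical combinations and the Casoratian\<close>
lemma trop_max_eq_Max:
  assumes "\<forall>i\<le>n. \<alpha> i \<in> Rmax" "\<exists>i\<le>n. \<alpha> i \<noteq> -\<infinity>" and I: "I = {j \<in> {0..n}. \<alpha> j \<noteq> -\<infinity>}"
  shows "trop_max {0..n} \<alpha> g x = ereal (Max ((\<lambda>j. real_of_ereal (\<alpha> j) + g j x) ` I))"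
proof -
  have fin: "finite I" "I \<noteq> {}" using assms(2) I by auto
  have real: "\<alpha> j + ereal (g j x) = ereal (real_of_ereal (\<alpha> j) + g j x)" if "j \<in> I" for j
    using that assms(1) I by (cases "\<alpha> j") (auto simp: Rmax_def)
  show ?thesis
    unfolding trop_max_def
  proof (rule antisym)
    show "(SUP i\<in>{0..n}. \<alpha> i + ereal (g i x))
        \<le> ereal (Max ((\<lambda>j. real_of_ereal (\<alpha> j) + g j x) ` I))"
    proof (rule SUP_least)
      fix i assume i: "i \<in> {0..n}"
      show "\<alpha> i + ereal (g i x) \<le> ereal (Max ((\<lambda>j. real_of_ereal (\<alpha> j) + g j x) ` I))"
      proof (cases "\<alpha> i = -\<infinity>")
        case False
        then have "i \<in> I" using i I by simp
        then show ?thesis using fin by (simp add: real)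
      qed simp
    qed
    have "Max ((\<lambda>j. real_of_ereal (\<alpha> j) + g j x) ` I) \<in> (\<lambda>j. real_of_ereal (\<alpha> j) + g j x) ` I"
      using fin by (intro Max_in) auto
    then obtain j where j: "j \<in> I"
        "Max ((\<lambda>j. real_of_ereal (\<alpha> j) + g j x) ` I) = real_of_ereal (\<alpha> j) + g j x"
      by blast
    show "ereal (Max ((\<lambda>j. real_of_ereal (\<alpha> j) + g j x) ` I))
        \<le> (SUP i\<in>{0..n}. \<alpha> i + ereal (g i x))"
      unfolding j(2) real[OF j(1), symmetric] using j(1) I by (intro SUP_upper) auto
  qed
qed

text \<open>The Casoratian exceeds its diagonal term by at most a sum of positive parts. Subtracting
  \<open>f\<^sub>0\<close> from every \<open>f\<^sub>j\<close> changes each permutation term by the same amount, so only the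
  differences \<open>d\<^sub>j = f\<^sub>j - f\<^sub>0\<close> matter; and \<open>d\<^sub>j(x + p(j)) - d\<^sub>j(x + j)\<close> is bounded by the summand
  \<open>l = p(j)\<close>, \<open>m = j\<close>.\<close>
lemma trop_casoratian_le:
  assumes "n \<le> q"
  shows "trop_casoratian n f x \<le> (\<Sum>j=0..n. f j (x + real j))
    + (\<Sum>j=1..q. \<Sum>l=0..n. \<Sum>m=0..n.
        max 0 ((f j (x + real l) - f 0 (x + real l)) - (f j (x + real m) - f 0 (x + real m))))"
proof -
  define d where "d = (\<lambda>j l. f j (x + real l) - f 0 (x + real l))"
  define E where "E = (\<lambda>j. \<Sum>l=0..n. \<Sum>m=0..n. max 0 (d j l - d j m))"
  have "(\<Sum>j=0..n. f j (x + real (p j))) \<le> (\<Sum>j=0..n. f j (x + real j)) + (\<Sum>j=1..q. E j)"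
    if p: "p permutes {0..n}" for p
  proof -
    have "(\<Sum>j=0..n. f 0 (x + real (p j))) = (\<Sum>j=0..n. f 0 (x + real j))"
      using sum.permute[OF p, of "\<lambda>j. f 0 (x + real j)"] by (simp add: o_def)
    then have "(\<Sum>j=0..n. f j (x + real (p j))) - (\<Sum>j=0..n. f j (x + real j))
        = (\<Sum>j=0..n. d j (p j) - d j j)"
      by (simp add: d_def sum_subtractf)
    also have "\<dots> = (\<Sum>j=1..n. d j (p j) - d j j)"
      by (simp add: sum.atLeast_Suc_atMost d_def)
    also have "\<dots> \<le> (\<Sum>j=1..n. E j)"
    proof (rule sum_mono)
      fix j assume j: "j \<in> {1..n}"
      then have pj: "p j \<in> {0..n}" using permutes_in_image[OF p, of j] by simp
      have "d j (p j) - d j j \<le> max 0 (d j (p j) - d j j)" by simp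
      also have "\<dots> \<le> (\<Sum>m=0..n. max 0 (d j (p j) - d j m))"
        using j by (intro member_le_sum[where f = "\<lambda>m. max 0 (d j (p j) - d j m)"]) auto
      also have "\<dots> \<le> E j"
        unfolding E_def using pj
        by (intro member_le_sum[where f = "\<lambda>l. \<Sum>m=0..n. max 0 (d j l - d j m)"])
           (auto intro: sum_nonneg)
      finally show "d j (p j) - d j j \<le> E j" .
    qed
    also have "\<dots> \<le> (\<Sum>j=1..q. E j)"
      using assms by (intro sum_mono2) (auto simp: E_def intro!: sum_nonneg)
    finally show ?thesis by simp
  qed
  then have "trop_casoratian n f x \<le> (\<Sum>j=0..n. f j (x + real j)) + (\<Sum>j=1..q. E j)"
    unfolding trop_casoratian_def
    by (intro Max.boundedI) (auto intro: permutes_id finite_permutations)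
  then show ?thesis by (simp add: E_def d_def)
qed

section \<open>The Cartan estimate with degenerate combinations\<close>
theorem theorem6p2:
  fixes q n lam :: nat and \<epsilon> :: real
    and g f :: "nat \<Rightarrow> real \<Rightarrow> real"
    and a :: "nat \<Rightarrow> nat \<Rightarrow> ereal"
    and G :: "real \<Rightarrow> (nat \<Rightarrow> ereal) set"
    and L Lt :: "real \<Rightarrow> real"
    and I :: "nat \<Rightarrow> nat set"
  assumes "0 < n" and "n < q" and "0 < \<epsilon>"
    and "\<forall>j\<le>n. tropical_entire (g j)"
    and "no_common_root n g"
    and "gm_independent n g"
    and "\<forall>k\<le>q. \<forall>i\<le>n. a i k \<in> Rmax"
    and "\<forall>k\<le>q. \<exists>i\<le>n. a i k \<noteq> -\<infinity>"
    and "\<forall>k\<le>q. \<forall>x. ereal (f k x) = trop_max {0..n} (\<lambda>i. a i k) g x"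
    and "lam = ddg_family n g {n+1..q} f"
    and "\<forall>x. Lt x = (\<Sum>j=0..n. f j (x + real j)) + (\<Sum>\<nu>=n+1..q. f \<nu> x) - trop_casoratian n f x"
    and "\<forall>x. L x = (\<Sum>j=0..q. f j x) - trop_casoratian n f x"
    and "\<forall>\<nu>. I \<nu> = {j \<in> {0..n}. a j \<nu> \<noteq> -\<infinity>}"
    and "reduced_representation n G g"
  shows "\<exists>r0\<ge>0.
    ((\<forall>\<nu>\<in>{n+1..q}. card (I \<nu>) = n + 1 \<longrightarrow> shortest_length n g (f \<nu>) = n + 1) \<longrightarrow> r0 = 0) \<and>
    (\<forall>r>r0.
      (real q - real n - real lam) * cartan_characteristic n g r
      \<le> nev_N r (\<lambda>x. - Lt x) - nev_N r Lt
        + (\<Sum>j=1..q. \<Sum>l=0..n. \<Sum>m=0..n.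
             nev_m r (\<lambda>x. (f j (x + real l) - f 0 (x + real l))
                         - (f j (x + real m) - f 0 (x + real m))))
        + L 0
        + (\<Sum>j=1..n. real_of_ereal (trop_max {0..n} (\<lambda>i. a i j) g (real j))
                     - real_of_ereal (trop_max {0..n} (\<lambda>i. a i j) g 0))
        - (\<Sum>\<nu> | \<nu> \<in> {n+1..q} \<and> card (I \<nu>) = n + 1.
             Min ((\<lambda>j. real_of_ereal (a j \<nu>)) ` I \<nu>))
        - (\<Sum>\<nu> | \<nu> \<in> {n+1..q} \<and> card (I \<nu>) < n + 1.
             Max ((\<lambda>j. real_of_ereal (a j \<nu>) + g j 0) ` I \<nu>))
        - (real q - real n - real lam) * Max ((\<lambda>j. g j 0) ` {0..n}))"
proof -
  note n = assms(1) and nq = assms(2) and entire = assms(4) and indep = assms(6)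
    and Rmax = assms(7) and real_coeff = assms(8) and f = assms(9) and lam = assms(10)
    and Lt = assms(11) and L = assms(12) and I = assms(13)
  define F where "F = (\<lambda>x. Max ((\<lambda>j. g j x) ` {0..n}))"
  define E where "E = (\<lambda>x. \<Sum>j=1..q. \<Sum>l=0..n. \<Sum>m=0..n.
    max 0 ((f j (x + real l) - f 0 (x + real l)) - (f j (x + real m) - f 0 (x + real m))))"
  define D where "D = {\<nu> \<in> {n+1..q}. shortest_length n g (f \<nu>) < n + 1}"
  \<comment> \<open>the constant that remains in the lower bound of \<open>f\<^sub>\<nu>\<close>: its term in the two sums over \<open>\<nu>\<close>\<close>
  define low where "low = (\<lambda>\<nu>. if card (I \<nu>) = n + 1
    then Min ((\<lambda>j. real_of_ereal (a j \<nu>)) ` I \<nu>)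
    else Max ((\<lambda>j. real_of_ereal (a j \<nu>) + g j 0) ` I \<nu>))"
  have pa_g: "piecewise_affine (g j)" if "j \<le> n" for j
    using entire that by (simp add: tropical_entire_def tropical_meromorphic_imp_piecewise_affine)
  have jump_g: "0 \<le> slope_jump (g j) s" if "j \<le> n" for j s
    using entire that by (auto simp: tropical_entire_def is_trop_pole_def not_less)
  have I_fin: "finite (I \<nu>)" "I \<nu> \<subseteq> {0..n}" for \<nu>
    using I by auto
  have I_ne: "I \<nu> \<noteq> {}" if "\<nu> \<le> q" for \<nu>
    using I real_coeff that by auto
  have f_Max: "f \<nu> x = Max ((\<lambda>j. real_of_ereal (a j \<nu>) + g j x) ` I \<nu>)" if "\<nu> \<le> q" for \<nu> x
  proof -
    have "ereal (f \<nu> x) = ereal (Max ((\<lambda>j. real_of_ereal (a j \<nu>) + g j x) ` I \<nu>))"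
      using f that trop_max_eq_Max[of n "\<lambda>i. a i \<nu>" "I \<nu>" g x] Rmax real_coeff I by simp
    then show ?thesis by simp
  qed
  have pa_f: "piecewise_affine (f \<nu>)" if "\<nu> \<le> q" for \<nu>
  proof -
    have "f \<nu> = (\<lambda>x. Max ((\<lambda>j. real_of_ereal (a j \<nu>) + g j x) ` I \<nu>))"
      using f_Max[OF that] by blast
    moreover have "piecewise_affine (\<lambda>x. Max ((\<lambda>j. real_of_ereal (a j \<nu>) + g j x) ` I \<nu>))"
      using I_fin(1) I_ne[OF that]
      by (intro piecewise_affine_Max piecewise_affine_add piecewise_affine_const pa_g)
         (auto dest: subsetD[OF I_fin(2)])
    ultimately show ?thesis by metis
  qed
  \<comment> \<open>a term that attains the maximum at \<open>0\<close> is midpoint convex and stays below \<open>f\<^sub>\<nu>\<close>\<close>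
  have midpoint_f: "f \<nu> 0 \<le> (f \<nu> r + f \<nu> (- r)) / 2" if "\<nu> \<le> q" "0 \<le> r" for \<nu> r
  proof -
    have "f \<nu> 0 \<in> (\<lambda>j. real_of_ereal (a j \<nu>) + g j 0) ` I \<nu>"
      unfolding f_Max[OF that(1)] using I_fin I_ne[OF that(1)] by (intro Max_in) auto
    then obtain j where j: "j \<in> I \<nu>" "f \<nu> 0 = real_of_ereal (a j \<nu>) + g j 0"
      by blast
    have "real_of_ereal (a j \<nu>) + g j x \<le> f \<nu> x" for x
      unfolding f_Max[OF that(1)] using I_fin j(1) by (intro Max_ge) auto
    from this[of r] this[of "- r"] show ?thesis
      using midpoint_of_nonneg_jumps[OF pa_g jump_g that(2), of j] j I_fin(2)[of \<nu>] by force
  qed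
  have full_bound: "F x + low \<nu> \<le> f \<nu> x" if "\<nu> \<le> q" "card (I \<nu>) = n + 1" for \<nu> x
  proof -
    have eq: "I \<nu> = {0..n}"
      using I_fin(2)[of \<nu>] that(2) by (intro card_subset_eq) auto
    have "F x \<in> (\<lambda>j. g j x) ` {0..n}"
      unfolding F_def by (intro Max_in) auto
    then obtain j where j: "j \<in> {0..n}" "F x = g j x" by blast
    have "low \<nu> \<le> real_of_ereal (a j \<nu>)"
      using j(1) that(2) by (simp add: low_def eq)
    moreover have "real_of_ereal (a j \<nu>) + g j x \<le> f \<nu> x"
      unfolding f_Max[OF that(1)] using j(1) by (intro Max_ge) (auto simp: eq)
    ultimately show ?thesis using j(2) by simp
  qed
  \<comment> \<open>the support of the coefficients is itself a representation of length below \<open>n + 1\<close>\<close>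
  have degenerate: "\<nu> \<in> D" if "\<nu> \<in> {n+1..q}" "card (I \<nu>) \<noteq> n + 1" for \<nu>
  proof -
    have "card (I \<nu>) \<le> card {0..n}" by (intro card_mono I_fin) auto
    then have "card (I \<nu>) < n + 1" using that(2) by simp
    moreover have "card (I \<nu>) \<ge> 1"
      using I_fin I_ne[of \<nu>] that(1) by (simp add: Suc_le_eq card_gt_0_iff)
    moreover have "shortest_length n g (f \<nu>) \<le> card (I \<nu>)"
      unfolding shortest_length_def
    proof (intro Least_le conjI exI allI)
      show "I \<nu> \<subseteq> {0..n}" by (rule I_fin)
      show "f \<nu> x = Max ((\<lambda>k. real_of_ereal (a k \<nu>) + g k x) ` I \<nu>)" for x
        using that(1) by (simp add: f_Max)
    qed (use calculation in auto)
    ultimately show ?thesis using that(1) by (simp add: D_def)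
  qed
  \<comment> \<open>in the tame case no mean of \<open>F\<close> has to be discarded, and every \<open>r > 0\<close> is admissible\<close>
  define tame where "tame \<longleftrightarrow>
    (\<forall>\<nu>\<in>{n+1..q}. card (I \<nu>) = n + 1 \<longrightarrow> shortest_length n g (f \<nu>) = n + 1)"
  obtain r1 where r1: "r1 \<ge> 0" "\<And>r. r > r1 \<Longrightarrow> 0 \<le> F r + F (- r)"
    using eventually_symmetric_sum_ge[OF n pa_g jump_g indep, of 0] unfolding F_def by blast
  define r0 where "r0 = (if tame then 0 else r1)"
  have r0: "r0 \<ge> 0" using r1 by (simp add: r0_def)
  have pa_Lt: "piecewise_affine Lt"
  proof -
    have "piecewise_affine (trop_casoratian n f)"
      unfolding trop_casoratian_def[abs_def] using nq
      by (intro piecewise_affine_Max piecewise_affine_sum piecewise_affine_shift pa_f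
            finite_permutations) (auto intro: permutes_id)
    moreover have "Lt = (\<lambda>x. (\<Sum>j=0..n. f j (x + real j)) + (\<Sum>\<nu>=n+1..q. f \<nu> x)
        + - trop_casoratian n f x)"
      using Lt by auto
    ultimately show ?thesis
      using nq by (simp only:, intro piecewise_affine_add piecewise_affine_sum
          piecewise_affine_shift piecewise_affine_uminus pa_f) auto
  qed
  have bound: "(real q - real n - real lam) * cartan_characteristic n g r
      \<le> nev_N r (\<lambda>x. - Lt x) - nev_N r Lt
        + (\<Sum>j=1..q. \<Sum>l=0..n. \<Sum>m=0..n.
             nev_m r (\<lambda>x. (f j (x + real l) - f 0 (x + real l))
                         - (f j (x + real m) - f 0 (x + real m))))
        + L 0
        + (\<Sum>j=1..n. real_of_ereal (trop_max {0..n} (\<lambda>i. a i j) g (real j))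
                     - real_of_ereal (trop_max {0..n} (\<lambda>i. a i j) g 0))
        - (\<Sum>\<nu> | \<nu> \<in> {n+1..q} \<and> card (I \<nu>) = n + 1.
             Min ((\<lambda>j. real_of_ereal (a j \<nu>)) ` I \<nu>))
        - (\<Sum>\<nu> | \<nu> \<in> {n+1..q} \<and> card (I \<nu>) < n + 1.
             Max ((\<lambda>j. real_of_ereal (a j \<nu>) + g j 0) ` I \<nu>))
        - (real q - real n - real lam) * Max ((\<lambda>j. g j 0) ` {0..n})"
    if "r > r0" for r
  proof -
    have r: "0 \<le> r" using that r0 by simp
    define M where "M = (F r + F (- r)) / 2"
    have each: "(if \<nu> \<in> D then 0 else M) + low \<nu> \<le> (f \<nu> r + f \<nu> (- r)) / 2"
      if \<nu>: "\<nu> \<in> {n+1..q}" for \<nu>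
    proof (cases "card (I \<nu>) = n + 1")
      case full: True
      have "F x + low \<nu> \<le> f \<nu> x" for x
        using full_bound[OF _ full] \<nu> by simp
      from this[of r] this[of "- r"] have "M + low \<nu> \<le> (f \<nu> r + f \<nu> (- r)) / 2"
        unfolding M_def by argo
      moreover have "0 \<le> M" if "\<nu> \<in> D"
      proof -
        have "\<not> tame" using that full \<nu> by (auto simp: tame_def D_def)
        then show ?thesis using r1(2)[of r] \<open>r > r0\<close> by (simp add: M_def r0_def)
      qed
      ultimately show ?thesis by auto
    next
      case False
      then have "low \<nu> = f \<nu> 0" using \<nu> by (simp add: low_def f_Max)
      then show ?thesis using midpoint_f[OF _ r, of \<nu>] degenerate[OF \<nu> False] \<nu> by simp
    qed
    have "(\<Sum>\<nu>=n+1..q. (if \<nu> \<in> D then 0 else M) + low \<nu>)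
        \<le> (\<Sum>\<nu>=n+1..q. (f \<nu> r + f \<nu> (- r)) / 2)"
      by (intro sum_mono each)
    moreover have "(\<Sum>\<nu>=n+1..q. if \<nu> \<in> D then 0 else M) = (real q - real n - real lam) * M"
    proof -
      have D: "D \<subseteq> {n+1..q}" "lam = card D"
        using lam by (auto simp: D_def ddg_family_def)
      have "(\<Sum>\<nu>=n+1..q. if \<nu> \<in> D then 0 else M) = (\<Sum>\<nu>\<in>{n+1..q} - D. M)"
        using D(1) by (intro sum.mono_neutral_cong_right) auto
      also have "\<dots> = real (card ({n+1..q} - D)) * M" by simp
      also have "card ({n+1..q} - D) = q - n - card D"
        using D(1) by (subst card_Diff_subset) (auto intro: finite_subset)
      also have "real (q - n - card D) = real q - real n - real lam"
        using card_mono[OF _ D(1)] nq D(2) by (simp add: of_nat_diff)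
      finally show ?thesis .
    qed
    moreover have "(\<Sum>\<nu>=n+1..q. low \<nu>)
        = (\<Sum>\<nu> | \<nu> \<in> {n+1..q} \<and> card (I \<nu>) = n + 1. Min ((\<lambda>j. real_of_ereal (a j \<nu>)) ` I \<nu>))
        + (\<Sum>\<nu> | \<nu> \<in> {n+1..q} \<and> card (I \<nu>) < n + 1.
             Max ((\<lambda>j. real_of_ereal (a j \<nu>) + g j 0) ` I \<nu>))"
    proof -
      have "card (I \<nu>) \<le> card {0..n}" for \<nu> by (intro card_mono I_fin) auto
      then have "card (I \<nu>) \<noteq> n + 1 \<longleftrightarrow> card (I \<nu>) < n + 1" for \<nu>
        by (metis Suc_eq_plus1 card_atLeastAtMost diff_zero linorder_neq_iff not_less)
      then show ?thesis
        unfolding low_def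
        by (subst sum.If_cases) (auto simp: Int_def intro!: arg_cong2[where f = "(+)"] sum.cong)
    qed
    ultimately have counted: "(real q - real n - real lam) * M
        + (\<Sum>\<nu> | \<nu> \<in> {n+1..q} \<and> card (I \<nu>) = n + 1. Min ((\<lambda>j. real_of_ereal (a j \<nu>)) ` I \<nu>))
        + (\<Sum>\<nu> | \<nu> \<in> {n+1..q} \<and> card (I \<nu>) < n + 1.
             Max ((\<lambda>j. real_of_ereal (a j \<nu>) + g j 0) ` I \<nu>))
        \<le> ((\<Sum>\<nu>=n+1..q. f \<nu> r) + (\<Sum>\<nu>=n+1..q. f \<nu> (- r))) / 2"
      by (simp add: sum.distrib sum_divide_distrib[symmetric])
    have cas: "(\<Sum>\<nu>=n+1..q. f \<nu> x) \<le> Lt x + E x" for x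
      using trop_casoratian_le[of n q f x] nq Lt unfolding E_def by simp
    have m_sum: "(\<Sum>j=1..q. \<Sum>l=0..n. \<Sum>m=0..n.
             nev_m r (\<lambda>x. (f j (x + real l) - f 0 (x + real l))
                         - (f j (x + real m) - f 0 (x + real m)))) = (E r + E (- r)) / 2"
      unfolding E_def nev_m_def by (simp only: sum.distrib sum_divide_distrib[symmetric])
    have jensen: "nev_N r (\<lambda>x. - Lt x) - nev_N r Lt = (Lt r + Lt (- r)) / 2 - Lt 0"
      by (rule tropical_jensen[OF pa_Lt r])
    have shifts: "L 0 + (\<Sum>j=1..n. real_of_ereal (trop_max {0..n} (\<lambda>i. a i j) g (real j))
                     - real_of_ereal (trop_max {0..n} (\<lambda>i. a i j) g 0)) = Lt 0"
    proof -
      have "real_of_ereal (trop_max {0..n} (\<lambda>i. a i j) g x) = f j x" if "j \<in> {1..n}" for j x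
        using f that nq by (metis atLeastAtMost_iff less_imp_le_nat order_trans real_of_ereal.simps(1))
      then have "(\<Sum>j=1..n. real_of_ereal (trop_max {0..n} (\<lambda>i. a i j) g (real j))
                     - real_of_ereal (trop_max {0..n} (\<lambda>i. a i j) g 0))
          = (\<Sum>j=1..n. f j (real j) - f j 0)"
        by (intro sum.cong) auto
      moreover have "(\<Sum>j=0..q. f j 0) = (\<Sum>j=0..n. f j 0) + (\<Sum>\<nu>=n+1..q. f \<nu> 0)"
        using sum.ub_add_nat[of 0 n "\<lambda>j. f j 0" "q - n"] nq by simp
      moreover have "(\<Sum>j=0..n. f j (real j)) = f 0 0 + (\<Sum>j=1..n. f j (real j))"
        "(\<Sum>j=0..n. f j 0) = f 0 0 + (\<Sum>j=1..n. f j 0)"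
        by (simp_all add: sum.atLeast_Suc_atMost)
      ultimately show ?thesis using L Lt by (simp add: sum_subtractf)
    qed
    have F0: "Max ((\<lambda>j. g j 0) ` {0..n}) = F 0" by (simp add: F_def)
    have T: "(real q - real n - real lam) * cartan_characteristic n g r
        = (real q - real n - real lam) * M - (real q - real n - real lam) * F 0"
      unfolding cartan_characteristic_def Let_def M_def F_def by (simp add: algebra_simps)
    show ?thesis
      unfolding F0 m_sum jensen T using counted cas[of r] cas[of "- r"] shifts by argo
  qed
  show ?thesis
  proof (intro exI[of _ r0] conjI allI impI)
    show "r0 = 0"
      if "\<forall>\<nu>\<in>{n+1..q}. card (I \<nu>) = n + 1 \<longrightarrow> shortest_length n g (f \<nu>) = n + 1"
      using that by (simp add: r0_def tame_def)
  qed (use r0 bound in auto)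
qed

end
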